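(* Let $R$ be a ring. The family $\mathcal{F}=\{I \text{ an ideal of } R : R/I \text{ is Dedekind finite}\}$ satisfies $(P_3)$. An ideal $I$ of $R$ maximal with respect to $R/I$ not being Dedekind finite is prime.
   Context: Rings are associative and unital, not necessarily commutative; "ideal" means two-sided ideal. A ring $A$ is Dedekind finite if $ab=1$ implies $ba=1$ for all $a,b\in A$. A family $\mathcal{F}$ of ideals of $R$ satisfies $(P_3)$ if $R\in\mathcal{F}$ and, for all $A,B\in\mathcal{F}$ and every ideal $I$ of $R$, $AB\subseteq I\subseteq A\cap B$ implies $I\in\mathcal{F}$. *)

theory Defs
  imports "HOL-Algebra.QuotRing" "HOL-Algebra.Ideal_Product"
begin

definition dedekind_finite :: "('a, 'b) ring_scheme \<Rightarrow> bool" where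
  "dedekind_finite A \<longleftrightarrow>
     (\<forall>a \<in> carrier A. \<forall>b \<in> carrier A.
        a \<otimes>\<^bsub>A\<^esub> b = \<one>\<^bsub>A\<^esub> \<longrightarrow> b \<otimes>\<^bsub>A\<^esub> a = \<one>\<^bsub>A\<^esub>)"

definition satisfies_P3 :: "('a, 'b) ring_scheme \<Rightarrow> 'a set set \<Rightarrow> bool" where
  "satisfies_P3 R \<F> \<longleftrightarrow>
     \<F> \<subseteq> {I. ideal I R} \<and>
     carrier R \<in> \<F> \<and>
     (\<forall>A \<in> \<F>. \<forall>B \<in> \<F>. \<forall>I.
        ideal I R \<and> A \<cdot>\<^bsub>R\<^esub> B \<subseteq> I \<and> I \<subseteq> A \<inter> B \<longrightarrow> I \<in> \<F>)"

(* The library locale primeideal extends cring and is the elementwise notion; over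
   noncommutative rings primeness is formulated with products of two-sided ideals. *)
definition prime_two_sided_ideal :: "'a set \<Rightarrow> ('a, 'b) ring_scheme \<Rightarrow> bool" where
  "prime_two_sided_ideal P R \<longleftrightarrow>
     ideal P R \<and> P \<noteq> carrier R \<and>
     (\<forall>A B. ideal A R \<and> ideal B R \<and> A \<cdot>\<^bsub>R\<^esub> B \<subseteq> P \<longrightarrow> A \<subseteq> P \<or> B \<subseteq> P)"

definition ideal_maximal_wrt :: "('a, 'b) ring_scheme \<Rightarrow> ('a set \<Rightarrow> bool) \<Rightarrow> 'a set \<Rightarrow> bool" where
  "ideal_maximal_wrt R Q I \<longleftrightarrow>
     ideal I R \<and> Q I \<and> (\<forall>J. ideal J R \<and> Q J \<and> I \<subseteq> J \<longrightarrow> J = I)"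

end

theory Submission
  imports Defs
begin

context ring
begin

text \<open>Dedekind finiteness of R/I says that 1 - ab in I forces 1 - ba in I
  (\<open>dedekind_finite_Quot_iff\<close>). Let AB \<subseteq> I \<subseteq> A \<inter> B with R/A
  and R/B Dedekind finite, and let 1 - ab be in I. Then e = 1 - ba lies in both A and B, so e^2 is
  in AB, hence in I. Since e = e^2 + b(1 - ab)a (\<open>one_minus_mult_decomp\<close>), e is in I.
  This is \<open>dedekind_finite_Quot_between\<close>. For primeness, if AB \<subseteq> I with
  neither factor inside I, then A + I and B + I properly contain I and still multiply into I. By
  maximality both have Dedekind finite quotients, so R/I would be Dedekind finite as well, a
  contradiction.\<close>

lemma dedekind_finite_Quot_iff:
  assumes "ideal I R"
  shows "dedekind_finite (R Quot I) \<longleftrightarrow>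
    (\<forall>a \<in> carrier R. \<forall>b \<in> carrier R. \<one> \<ominus> a \<otimes> b \<in> I \<longrightarrow> \<one> \<ominus> b \<otimes> a \<in> I)"
proof -
  interpret I: ideal I R by fact
  have eq: "(I +> a) \<otimes>\<^bsub>R Quot I\<^esub> (I +> b) = \<one>\<^bsub>R Quot I\<^esub> \<longleftrightarrow> \<one> \<ominus> a \<otimes> b \<in> I"
    if "a \<in> carrier R" "b \<in> carrier R" for a b
    using that quotient_eq_iff_same_a_r_cos[OF assms, of \<one> "a \<otimes> b"]
    by (auto simp: FactRing_def I.rcoset_mult_add)
  have car: "carrier (R Quot I) = (\<lambda>a. I +> a) ` carrier R"
    by (auto simp: FactRing_def A_RCOSETS_def')
  show ?thesis
    by (simp add: dedekind_finite_def car eq)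
qed

text \<open>If \<open>1 - ab\<close> lies in an ideal \<open>I\<close>, this shows that \<open>1 - ba\<close> is idempotent modulo \<open>I\<close>.\<close>

lemma one_minus_mult_decomp:
  assumes "a \<in> carrier R" "b \<in> carrier R"
  shows "\<one> \<ominus> b \<otimes> a = (\<one> \<ominus> b \<otimes> a) \<otimes> (\<one> \<ominus> b \<otimes> a) \<oplus> b \<otimes> (\<one> \<ominus> a \<otimes> b) \<otimes> a"
proof -
  let ?e = "\<one> \<ominus> b \<otimes> a"
  have "?e \<oplus> b \<otimes> a = \<one>"
    using assms by (simp add: a_minus_def a_assoc l_neg)
  then have "?e = ?e \<otimes> (?e \<oplus> b \<otimes> a)"
    using assms by simp
  also have "\<dots> = ?e \<otimes> ?e \<oplus> ?e \<otimes> (b \<otimes> a)"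
    using assms by (simp add: r_distr)
  \<comment> \<open>Both sides expand to ba - baba.\<close>
  also have "?e \<otimes> (b \<otimes> a) = b \<otimes> (\<one> \<ominus> a \<otimes> b) \<otimes> a"
    using assms by (simp add: a_minus_def l_distr r_distr l_minus r_minus m_assoc)
  finally show ?thesis .
qed

lemma dedekind_finite_Quot_between:
  assumes "ideal A R" "ideal B R" "ideal I R"
    and "dedekind_finite (R Quot A)" "dedekind_finite (R Quot B)"
    and "A \<cdot> B \<subseteq> I" "I \<subseteq> A \<inter> B"
  shows "dedekind_finite (R Quot I)"
  unfolding dedekind_finite_Quot_iff[OF assms(3)]
proof (intro ballI impI)
  fix a b
  assume ab: "a \<in> carrier R" "b \<in> carrier R" "\<one> \<ominus> a \<otimes> b \<in> I"
  interpret I: ideal I R by fact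
  let ?e = "\<one> \<ominus> b \<otimes> a"
  \<comment> \<open>As I \<subseteq> A \<inter> B, the element 1 - ab lies in A and in B, so the
    finiteness of each quotient applies.\<close>
  have "?e \<in> A" "?e \<in> B"
    using assms ab by (auto simp: dedekind_finite_Quot_iff)
  then have "?e \<otimes> ?e \<in> I"
    using assms(6) ideal_prod.prod[of ?e A ?e B R] by (meson subsetD)
  moreover have "b \<otimes> (\<one> \<ominus> a \<otimes> b) \<otimes> a \<in> I"
    using ab by (intro I.I_r_closed I.I_l_closed) auto
  ultimately show "?e \<in> I"
    by (subst one_minus_mult_decomp[OF ab(1,2)]) (rule I.a_closed)
qed

text \<open>The quotient is the zero ring. This gives both the membership of R in the family and the
  properness of the maximal ideal.\<close>

lemma dedekind_finite_Quot_carrier: "dedekind_finite (R Quot (carrier R))"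
  by (simp add: dedekind_finite_Quot_iff oneideal)

lemma ideal_prod_subset_ideal:
  assumes "ideal I R" "\<And>x y. x \<in> A \<Longrightarrow> y \<in> B \<Longrightarrow> x \<otimes> y \<in> I"
  shows "A \<cdot> B \<subseteq> I"
proof
  interpret I: ideal I R by fact
  fix x assume "x \<in> A \<cdot> B"
  then show "x \<in> I"
    by (induction rule: ideal_prod.induct) (auto intro: assms(2))
qed

text \<open>In (a + i)(b + j) every term except ab has a factor in I. Passing to A + I and B + I
  supplies the inclusion of I in both factors that \<open>dedekind_finite_Quot_between\<close>
  requires and that A and B themselves may lack.\<close>

lemma ideal_prod_add_ideal_subset:
  assumes "ideal A R" "ideal B R" "ideal I R" "A \<cdot> B \<subseteq> I"
  shows "(A <+>\<^bsub>R\<^esub> I) \<cdot> (B <+>\<^bsub>R\<^esub> I) \<subseteq> I"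
proof (rule ideal_prod_subset_ideal[OF assms(3)])
  interpret A: ideal A R by fact
  interpret B: ideal B R by fact
  interpret I: ideal I R by fact
  fix x y assume "x \<in> A <+>\<^bsub>R\<^esub> I" "y \<in> B <+>\<^bsub>R\<^esub> I"
  then obtain a i b j where ab: "a \<in> A" "i \<in> I" "b \<in> B" "j \<in> I"
    and xy: "x = a \<oplus> i" "y = b \<oplus> j"
    by (auto simp: set_add_def')
  have c: "a \<in> carrier R" "i \<in> carrier R" "b \<in> carrier R" "j \<in> carrier R"
    using ab by auto
  have "x \<otimes> y = a \<otimes> b \<oplus> (i \<otimes> b \<oplus> (a \<oplus> i) \<otimes> j)"
    unfolding xy using c by algebra
  moreover have "a \<otimes> b \<in> I"
    using ab assms(4) ideal_prod.prod[of a A b B R] by (meson subsetD)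
  ultimately show "x \<otimes> y \<in> I"
    using ab c by (simp add: I.I_l_closed I.I_r_closed)
qed

lemma subset_add_ideal:
  assumes "ideal A R" "ideal I R"
  shows "A \<subseteq> A <+>\<^bsub>R\<^esub> I" "I \<subseteq> A <+>\<^bsub>R\<^esub> I"
proof -
  interpret A: ideal A R by fact
  interpret I: ideal I R by fact
  show "A \<subseteq> A <+>\<^bsub>R\<^esub> I"
    by (force simp: set_add_def' intro: bexI[of _ \<zero>])
  show "I \<subseteq> A <+>\<^bsub>R\<^esub> I"
    by (force simp: set_add_def' intro: bexI[of _ \<zero>])
qed

lemma prime_if_maximal_not_dedekind_finite:
  assumes "ideal_maximal_wrt R (\<lambda>J. \<not> dedekind_finite (R Quot J)) I"
  shows "prime_two_sided_ideal I R"
proof -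
  have I: "ideal I R" and notDF: "\<not> dedekind_finite (R Quot I)"
    and max: "\<And>J. ideal J R \<Longrightarrow> I \<subseteq> J \<Longrightarrow> J \<noteq> I \<Longrightarrow> dedekind_finite (R Quot J)"
    using assms by (auto simp: ideal_maximal_wrt_def)
  \<comment> \<open>Since C \<subseteq> C + I but C is not inside I, the sum differs from I and
    maximality applies to it.\<close>
  have DF: "ideal (C <+>\<^bsub>R\<^esub> I) R \<and> I \<subseteq> C <+>\<^bsub>R\<^esub> I \<and> dedekind_finite (R Quot (C <+>\<^bsub>R\<^esub> I))"
    if "ideal C R" "\<not> C \<subseteq> I" for C
    using that max[of "C <+>\<^bsub>R\<^esub> I"] add_ideals[OF that(1) I] subset_add_ideal[OF that(1) I] by blast
  have "A \<subseteq> I \<or> B \<subseteq> I" if "ideal A R" "ideal B R" "A \<cdot> B \<subseteq> I" for A B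
    using that notDF DF[of A] DF[of B] ideal_prod_add_ideal_subset[OF that(1,2) I that(3)]
      dedekind_finite_Quot_between[of "A <+>\<^bsub>R\<^esub> I" "B <+>\<^bsub>R\<^esub> I" I] I by blast
  moreover have "I \<noteq> carrier R"
    using notDF dedekind_finite_Quot_carrier by blast
  ultimately show ?thesis
    using I by (auto simp: prime_two_sided_ideal_def)
qed

end

theorem proposition3p12:
  fixes R :: "('a, 'b) ring_scheme"
  assumes "ring R"
  shows "satisfies_P3 R {I. ideal I R \<and> dedekind_finite (R Quot I)} \<and>
         (\<forall>I. ideal_maximal_wrt R (\<lambda>J. \<not> dedekind_finite (R Quot J)) I
              \<longrightarrow> prime_two_sided_ideal I R)"
proof -
  interpret ring R by fact
  have "satisfies_P3 R {I. ideal I R \<and> dedekind_finite (R Quot I)}"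
    unfolding satisfies_P3_def
    using dedekind_finite_Quot_between oneideal dedekind_finite_Quot_carrier by blast
  then show ?thesis
    using prime_if_maximal_not_dedekind_finite by blast
qed

end
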